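(* Let $\Psi:\mathbb{R}^d\to\mathbb{R}^d$ be a continuous bijection with $\Psi(0)\ne0$. For $h\in C_b^2(\mathbb{R}^d\times\mathbb{R}^d)$ and $x,y\in\mathbb{R}^d$ define $$\begin{aligned}\widetilde Lh(x,y)=&\ \langle\nabla_xh(x,y),b(x)\rangle+\langle\nabla_yh(x,y),b(y)\rangle\\&+\frac12\int\Big(h(x+\sigma(x)z,y+\sigma(y)\Psi(z))-h(x,y)-\langle\nabla_xh(x,y),\sigma(x)z\rangle\mathbf 1_{\{|z|\le1\}}\\&\qquad\quad-\langle\nabla_yh(x,y),\sigma(y)\Psi(z)\rangle\mathbf 1_{\{|\Psi(z)|\le1\}}\Big)\mu_\Psi(dz)\\&+\frac12\int\Big(h(x+\sigma(x)z,y+\sigma(y)\Psi^{-1}(z))-h(x,y)-\langle\nabla_xh(x,y),\sigma(x)z\rangle\mathbf 1_{\{|z|\le1\}}\\&\qquad\quad-\langle\nabla_yh(x,y),\sigma(y)\Psi^{-1}(z)\rangle\mathbf 1_{\{|\Psi^{-1}(z)|\le1\}}\Big)\mu_{\Psi^{-1}}(dz)\\&+\int\Big(h(x+\sigma(x)z,y+\sigma(y)z)-h(x,y)-\langle\nabla_xh(x,y),\sigma(x)z\rangle\mathbf 1_{\{|z|\le1\}}\\&\qquad\quad-\langle\nabla_yh(x,y),\sigma(y)z\rangle\mathbf 1_{\{|z|\le1\}}\Big)\Big(\nu-\tfrac12\mu_\Psi-\tfrac12\mu_{\Psi^{-1}}\Big)(dz).\end{aligned}$$ Then $\widetilde L$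 is a coupling operator of the operator $$Lf(x)=\langle\nabla f(x),b(x)\rangle+\int\Big(f(x+\sigma(x)z)-f(x)-\langle\nabla f(x),\sigma(x)z\rangle\mathbf 1_{\{|z|\le1\}}\Big)\nu(dz),\quad f\in C_b^2(\mathbb{R}^d);$$ that is, for all $f,g\in C_b^2(\mathbb{R}^d)$, with $h(x,y)=f(x)+g(y)$, one has $\widetilde Lh(x,y)=Lf(x)+Lg(y)$ for all $x,y\in\mathbb{R}^d$.
   Context: $b:\mathbb{R}^d\to\mathbb{R}^d$ is measurable, $\sigma:\mathbb{R}^d\to\mathbb{R}^d\otimes\mathbb{R}^d$ is continuous ($d\times d$ matrices), and $\nu$ is a Lévy measure on $\mathbb{R}^d$ ($\nu(\{0\})=0$, $\int(1\wedge|z|^2)\nu(dz)<\infty$). $C_b^2$ denotes bounded $C^2$ functions with bounded derivatives up to order 2; $\nabla_x h,\nabla_y h$ are the gradients in the first and second variables. Measures $\mu_\Psi$: for a continuous bijection $\Psi$ of $\mathbb{R}^d$ with $\Psi(0)\ne 0$, put $\nu_n(A)=\nu(A\cap\{|z|>1/n\})$, $(\nu_n\Psi)(A)=\nu_n(\Psi(A))$, and $$\mu_\Psi=\limsup_{n\to\infty}\big(\nu_n\wedge(\nu_n\Psi)\big),$$ where for finite measures $\mu_1\wedge\mu_2:=\mu_1-(\mu_1-\mu_2)^+$, with $(\mu_1-\mu_2)^+$ the positive part in the Jordan–Hahn decomposition. $\mu_{\Psi^{-1}}$ is defined in the same way with $\Psi^{-1}$ in place of $\Psi$. (Both are finite measures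 dominated by $\nu$.) *)

theory Defs
  imports "HOL-Analysis.Analysis"
begin

definition Cb2 :: "('a::real_normed_vector \<Rightarrow> real) set" where
  "Cb2 = {f. bounded (range f) \<and>
     (\<exists>(f' :: 'a \<Rightarrow> 'a \<Rightarrow>\<^sub>L real) (f'' :: 'a \<Rightarrow> 'a \<Rightarrow>\<^sub>L ('a \<Rightarrow>\<^sub>L real)).
        (\<forall>x. (f has_derivative blinfun_apply (f' x)) (at x)) \<and>
        (\<forall>x. (f' has_derivative blinfun_apply (f'' x)) (at x)) \<and>
        continuous_on UNIV f'' \<and> bounded (range f') \<and> bounded (range f''))}"

definition gradient :: "('a::real_inner \<Rightarrow> real) \<Rightarrow> 'a \<Rightarrow> 'a" where
  "gradient f x = (THE D. GDERIV f x :> D)"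

definition levy_measure :: "'a::euclidean_space measure \<Rightarrow> bool" where
  "levy_measure \<nu> \<longleftrightarrow> sets \<nu> = sets borel \<and> emeasure \<nu> {0} = 0 \<and>
     (\<integral>\<^sup>+ z. ennreal (min 1 ((norm z)\<^sup>2)) \<partial>\<nu>) < \<infinity>"

definition is_hahn_set :: "'a measure \<Rightarrow> 'a measure \<Rightarrow> 'a set \<Rightarrow> bool" where
  "is_hahn_set M N P \<longleftrightarrow> P \<in> sets M \<and>
     (\<forall>A\<in>sets M. A \<subseteq> P \<longrightarrow> emeasure N A \<le> emeasure M A) \<and>
     (\<forall>A\<in>sets M. A \<inter> P = {} \<longrightarrow> emeasure M A \<le> emeasure N A)"

text \<open>Positive part \<open>(M - N)\<^sup>+\<close> in the Jordan--Hahn decomposition of the signed measure \<open>M - N\<close>,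
  for finite \<open>M\<close>, \<open>N\<close> with the same measurable sets. It does not depend on the choice of the
  Hahn set, which exists by finite_unsigned_Hahn_decomposition.\<close>

definition jordan_pos :: "'a measure \<Rightarrow> 'a measure \<Rightarrow> 'a measure" where
  "jordan_pos M N = (let P = (SOME P. is_hahn_set M N P) in
     measure_of (space M) (sets M) (\<lambda>A. emeasure M (A \<inter> P) - emeasure N (A \<inter> P)))"

definition meet_measure :: "'a measure \<Rightarrow> 'a measure \<Rightarrow> 'a measure" where
  "meet_measure M N = diff_measure M (jordan_pos M N)"

definition trunc_measure :: "'a::real_normed_vector measure \<Rightarrow> nat \<Rightarrow> 'a measure" where
  "trunc_measure \<nu> n = density \<nu> (indicator {z. norm z > 1 / real n})"

definition comp_measure :: "'a::topological_space measure \<Rightarrow> ('a \<Rightarrow> 'a) \<Rightarrow> 'a measure" where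
  "comp_measure M \<Psi> = measure_of UNIV (sets borel) (\<lambda>A. emeasure M (\<Psi> ` A))"

text \<open>The limit superior is taken setwise; the sequence is increasing in \<open>n \<ge> 1\<close>, so this is a
  measure. The index \<open>n = 0\<close>, where \<open>1 / 0 = 0\<close>, does not affect it.\<close>

definition mu_measure :: "'a::real_normed_vector measure \<Rightarrow> ('a \<Rightarrow> 'a) \<Rightarrow> 'a measure" where
  "mu_measure \<nu> \<Psi> = measure_of UNIV (sets borel) (\<lambda>A. limsup (\<lambda>n.
     emeasure (meet_measure (trunc_measure \<nu> n) (comp_measure (trunc_measure \<nu> n) \<Psi>)) A))"

definition levy_op ::
  "(real^'d \<Rightarrow> real^'d) \<Rightarrow> (real^'d \<Rightarrow> real^'d^'d) \<Rightarrow> (real^'d) measure \<Rightarrow>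
   (real^'d \<Rightarrow> real) \<Rightarrow> real^'d \<Rightarrow> real" where
  "levy_op b \<sigma> \<nu> f x = gradient f x \<bullet> b x +
     (\<integral>z. (f (x + \<sigma> x *v z) - f x
            - (gradient f x \<bullet> (\<sigma> x *v z)) * indicator {w. norm w \<le> 1} z) \<partial>\<nu>)"

definition grad1 :: "('a::real_inner \<times> 'b \<Rightarrow> real) \<Rightarrow> 'a \<Rightarrow> 'b \<Rightarrow> 'a" where
  "grad1 h x y = gradient (\<lambda>u. h (u, y)) x"

definition grad2 :: "('a \<times> 'b::real_inner \<Rightarrow> real) \<Rightarrow> 'a \<Rightarrow> 'b \<Rightarrow> 'b" where
  "grad2 h x y = gradient (\<lambda>v. h (x, v)) y"

definition coupled_levy_op ::
  "(real^'d \<Rightarrow> real^'d) \<Rightarrow> (real^'d \<Rightarrow> real^'d^'d) \<Rightarrow> (real^'d) measure \<Rightarrow>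
   (real^'d \<Rightarrow> real^'d) \<Rightarrow> ((real^'d) \<times> (real^'d) \<Rightarrow> real) \<Rightarrow> real^'d \<Rightarrow> real^'d \<Rightarrow> real" where
  "coupled_levy_op b \<sigma> \<nu> \<Psi> h x y =
     grad1 h x y \<bullet> b x + grad2 h x y \<bullet> b y
     + 1/2 * (\<integral>z. (h (x + \<sigma> x *v z, y + \<sigma> y *v \<Psi> z) - h (x, y)
            - (grad1 h x y \<bullet> (\<sigma> x *v z)) * indicator {w. norm w \<le> 1} z
            - (grad2 h x y \<bullet> (\<sigma> y *v \<Psi> z)) * indicator {w. norm w \<le> 1} (\<Psi> z))
          \<partial>mu_measure \<nu> \<Psi>)
     + 1/2 * (\<integral>z. (h (x + \<sigma> x *v z, y + \<sigma> y *v inv \<Psi> z) - h (x, y)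
            - (grad1 h x y \<bullet> (\<sigma> x *v z)) * indicator {w. norm w \<le> 1} z
            - (grad2 h x y \<bullet> (\<sigma> y *v inv \<Psi> z)) * indicator {w. norm w \<le> 1} (inv \<Psi> z))
          \<partial>mu_measure \<nu> (inv \<Psi>))
     + (\<integral>z. (h (x + \<sigma> x *v z, y + \<sigma> y *v z) - h (x, y)
            - (grad1 h x y \<bullet> (\<sigma> x *v z)) * indicator {w. norm w \<le> 1} z
            - (grad2 h x y \<bullet> (\<sigma> y *v z)) * indicator {w. norm w \<le> 1} z)
          \<partial>diff_measure (diff_measure \<nu> (scale_measure (1/2) (mu_measure \<nu> \<Psi>)))
                        (scale_measure (1/2) (mu_measure \<nu> (inv \<Psi>))))"

definition is_coupling_operator ::
  "(('a::real_normed_vector \<times> 'a \<Rightarrow> real) \<Rightarrow> 'a \<Rightarrow> 'a \<Rightarrow> real) \<Rightarrow>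
   (('a \<Rightarrow> real) \<Rightarrow> 'a \<Rightarrow> real) \<Rightarrow> bool" where
  "is_coupling_operator Lt L \<longleftrightarrow>
     (\<forall>f\<in>Cb2. \<forall>g\<in>Cb2. \<forall>x y. Lt (\<lambda>(u, v). f u + g v) x y = L f x + L g y)"

end

theory Submission
  imports Defs
begin

text \<open>
  The meet of two finite measures is
  \<open>(\<mu>\<^sub>1 \<and> \<mu>\<^sub>2)(A) = inf\<^sub>B (\<mu>\<^sub>1(A - B) + \<mu>\<^sub>2(A \<inter> B))\<close>. This formula shows that the truncated
  meets increase, that \<open>\<mu>\<^sub>\<Psi>\<close> is dominated by \<open>\<nu>\<close> and by \<open>\<nu>\<Psi>\<close>, and, exchanging \<open>B\<close> with the complement
  of its image, that \<open>\<Psi>\<close> pushes \<open>\<mu>\<^sub>\<Psi>\<close> forward to the measure of \<open>\<Psi>\<inverse>\<close>, where \<open>\<Psi>\<inverse>\<close> is continuous by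
  invariance of domain. For \<open>h(x,y) = f(x) + g(y)\<close> the integrands split into \<open>F(z) + G(\<Psi>(z))\<close> and its
  analogues, where \<open>F\<close> and \<open>G\<close> are \<open>\<nu>\<close>-integrable by Taylor's formula. The pushforward turns the \<open>G\<close>-parts
  of the first two integrals into integrals of \<open>G\<close> against \<open>\<mu>\<close> of \<open>\<Psi>\<inverse>\<close> and \<open>\<mu>\<^sub>\<Psi>\<close>, and all
  contributions recombine to integrals against \<open>\<nu>\<close>.
\<close>

section \<open>Differences of measures and the meet of two finite measures\<close>

text \<open>Only \<open>N\<close> has to be finite, because \<open>M\<close> will also be the
  possibly infinite \<nu>. Countable additivity follows by adding the value of \<open>N\<close> on
  the union to both sides and cancelling it, which its finiteness permits.\<close>

lemma emeasure_diff_measure_finite: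
  assumes fin: "finite_measure N" and sets_eq: "sets M = sets N"
  assumes le: "\<And>A. A \<in> sets M \<Longrightarrow> emeasure N A \<le> emeasure M A" and A: "A \<in> sets M"
  shows "emeasure (diff_measure M N) A = emeasure M A - emeasure N A" (is "_ = ?\<mu> A")
  unfolding diff_measure_def
proof (rule emeasure_measure_of_sigma)
  interpret N: finite_measure N by fact
  show "sigma_algebra (space M) (sets M)" ..
  show "positive (sets M) ?\<mu>"
    by (simp add: positive_def)
  show "countably_additive (sets M) ?\<mu>"
  proof (rule countably_additiveI)
    fix A :: "nat \<Rightarrow> _" assume A: "range A \<subseteq> sets M" and disj: "disjoint_family A"
    have "(\<Sum>i. ?\<mu> (A i)) + emeasure N (\<Union>i. A i) = (\<Sum>i. ?\<mu> (A i)) + (\<Sum>i. emeasure N (A i))"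
      using A disj by (simp add: suminf_emeasure sets_eq)
    also have "\<dots> = (\<Sum>i. ?\<mu> (A i) + emeasure N (A i))"
      by (simp add: suminf_add)
    also have "\<dots> = (\<Sum>i. emeasure M (A i))"
      using A le by (intro suminf_cong) (auto intro!: diff_add_cancel_ennreal)
    also have "\<dots> = emeasure M (\<Union>i. A i)"
      using A disj by (simp add: suminf_emeasure)
    finally show "(\<Sum>i. ?\<mu> (A i)) = ?\<mu> (\<Union>i. A i)"
      by (metis N.emeasure_finite ennreal_add_diff_cancel_right)
  qed
qed fact

lemma is_hahn_set_some:
  assumes "finite_measure M" "finite_measure N" "sets N = sets M"
  shows "is_hahn_set M N (SOME P. is_hahn_set M N P)"
proof -
  have "\<exists>P. is_hahn_set M N P"
    using finite_unsigned_Hahn_decomposition[OF assms] unfolding is_hahn_set_def by blast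
  then show ?thesis
    by (rule someI_ex)
qed

text \<open>The positive part of \<open>M - N\<close> lives on the Hahn set \<open>P\<close>, where
  it equals \<open>M - N\<close>. Removing it from \<open>M\<close> leaves \<open>N\<close> on
  \<open>P\<close> and \<open>M\<close> off \<open>P\<close>.\<close>

lemma emeasure_meet_measure_hahn:
  assumes fin: "finite_measure M" "finite_measure N" and sets_eq: "sets N = sets M"
  obtains P where "is_hahn_set M N P"
    "\<And>A. A \<in> sets M \<Longrightarrow> emeasure (meet_measure M N) A = emeasure M (A - P) + emeasure N (A \<inter> P)"
proof
  interpret M: finite_measure M by fact
  interpret N: finite_measure N by fact
  define P where "P = (SOME P. is_hahn_set M N P)"
  show P: "is_hahn_set M N P"
    unfolding P_def using assms by (rule is_hahn_set_some)
  have [measurable]: "P \<in> sets M" and le: "\<And>A. A \<in> sets M \<Longrightarrow> A \<subseteq> P \<Longrightarrow> emeasure N A \<le> emeasure M A"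
    using P by (auto simp: is_hahn_set_def)
  have PN: "P \<in> sets N" by (simp add: sets_eq)
  let ?D = "\<lambda>M. density M (indicator P)"
  have D: "emeasure (?D M) A = emeasure M (A \<inter> P)" "emeasure (?D N) A = emeasure N (A \<inter> P)"
    if "A \<in> sets M" for A
    using that PN by (simp_all add: emeasure_restricted sets_eq Int_commute)
  have "finite_measure (?D N)"
    using PN by (intro finite_measureI)
      (simp add: emeasure_restricted)
  \<comment> \<open>As a difference of the restrictions to \<open>P\<close>, the positive part is
    covered by \<open>emeasure_diff_measure_finite\<close>, which shows that its defining set
    function really is a measure.\<close>
  have J_eq: "jordan_pos M N = diff_measure (?D M) (?D N)"
    unfolding jordan_pos_def diff_measure_def Let_def P_def[symmetric]
    using D sets.space_closed[of M] by (auto intro!: measure_of_eq simp: sets.sigma_sets_eq)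
  have J: "emeasure (jordan_pos M N) A = emeasure M (A \<inter> P) - emeasure N (A \<inter> P)"
    if "A \<in> sets M" for A
    unfolding J_eq using that le \<open>finite_measure (?D N)\<close>
    by (subst emeasure_diff_measure_finite) (auto simp: D sets_eq)
  have [simp]: "sets (jordan_pos M N) = sets M" "space (jordan_pos M N) = space M"
    by (simp_all add: jordan_pos_def Let_def)
  have J_le: "emeasure (jordan_pos M N) A \<le> emeasure M (A \<inter> P)" if "A \<in> sets M" for A
    using that by (simp add: J diff_le_self_ennreal)
  fix A assume A[measurable]: "A \<in> sets M"
  have J_le_M: "emeasure (jordan_pos M N) A \<le> emeasure M A" if A: "A \<in> sets M" for A
    using J_le[OF A] emeasure_mono[of "A \<inter> P" A M] A by auto
  have "finite_measure (jordan_pos M N)"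
    using J_le_M[OF sets.top] M.emeasure_finite[of "space M"]
    by (intro finite_measureI) (auto simp: top_unique)
  then have "emeasure (meet_measure M N) A
      = emeasure M A - (emeasure M (A \<inter> P) - emeasure N (A \<inter> P))"
    unfolding meet_measure_def using A J J_le_M by (subst emeasure_diff_measure_finite) auto
  also have "emeasure M A = emeasure M (A - P) + emeasure M (A \<inter> P)"
    by (subst plus_emeasure) (auto intro!: arg_cong[where f="emeasure M"])
  also have "\<dots> = emeasure M (A - P) + emeasure N (A \<inter> P)
      + (emeasure M (A \<inter> P) - emeasure N (A \<inter> P))"
    using le[of "A \<inter> P"] by (simp add: add.assoc add_diff_inverse_ennreal)
  also have "\<dots> - (emeasure M (A \<inter> P) - emeasure N (A \<inter> P))
      = emeasure M (A - P) + emeasure N (A \<inter> P)"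
    by (intro ennreal_add_diff_cancel_right)
       (use M.emeasure_finite[of "A \<inter> P"] in \<open>simp add: ennreal_minus_eq_top\<close>)
  finally show "emeasure (meet_measure M N) A = emeasure M (A - P) + emeasure N (A \<inter> P)" .
qed

text \<open>The infimum is attained at a Hahn set. The formula no longer mentions that choice and is
  visibly monotone in both measures, which makes meets for different truncations comparable.\<close>

lemma emeasure_meet_measure:
  assumes fin: "finite_measure M" "finite_measure N" and sets_eq: "sets N = sets M"
    and A[measurable]: "A \<in> sets M"
  shows "emeasure (meet_measure M N) A = (INF B\<in>sets M. emeasure M (A - B) + emeasure N (A \<inter> B))"
proof -
  obtain P where P: "is_hahn_set M N P" and
    eq: "emeasure (meet_measure M N) A = emeasure M (A - P) + emeasure N (A \<inter> P)"
    using emeasure_meet_measure_hahn[OF fin sets_eq] A by metis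
  have [measurable]: "P \<in> sets M"
    and le: "\<And>A. A \<in> sets M \<Longrightarrow> A \<subseteq> P \<Longrightarrow> emeasure N A \<le> emeasure M A"
    and ge: "\<And>A. A \<in> sets M \<Longrightarrow> A \<inter> P = {} \<Longrightarrow> emeasure M A \<le> emeasure N A"
    using P by (auto simp: is_hahn_set_def)
  show ?thesis
    unfolding eq
  proof (intro antisym INF_greatest)
    fix B assume [measurable]: "B \<in> sets M"
    \<comment> \<open>The sets \<open>P\<close> and \<open>B\<close> cut \<open>A\<close> into four
      pieces. Both sides use the same measure on \<open>A - P - B\<close> and on
      \<open>A \<inter> P \<inter> B\<close>; on the other two pieces the Hahn property gives the
      inequality.\<close>
    have "emeasure M (A - P) = emeasure M (A - P - B) + emeasure M (A \<inter> B - P)"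
      by (subst plus_emeasure) (auto intro!: arg_cong[where f="emeasure M"])
    moreover have "emeasure M (A \<inter> B - P) \<le> emeasure N (A \<inter> B - P)"
      by (rule ge) auto
    moreover have "emeasure N (A \<inter> P) = emeasure N (A \<inter> P \<inter> B) + emeasure N (A \<inter> P - B)"
      by (subst plus_emeasure) (auto intro!: arg_cong[where f="emeasure N"] simp: sets_eq)
    moreover have "emeasure N (A \<inter> P - B) \<le> emeasure M (A \<inter> P - B)"
      by (rule le) auto
    moreover have "emeasure M (A - B) = emeasure M (A - P - B) + emeasure M (A \<inter> P - B)"
      by (subst plus_emeasure) (auto intro!: arg_cong[where f="emeasure M"])
    moreover have "emeasure N (A \<inter> B) = emeasure N (A \<inter> P \<inter> B) + emeasure N (A \<inter> B - P)"
      by (subst plus_emeasure) (auto intro!: arg_cong[where f="emeasure N"] simp: sets_eq)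
    ultimately show "emeasure M (A - P) + emeasure N (A \<inter> P) \<le> emeasure M (A - B) + emeasure N (A \<inter> B)"
      by (smt (verit) add.assoc add.commute add_mono order_refl)
  qed (auto intro: INF_lower)
qed

section \<open>Truncated Levy measures and their images under a homeomorphism\<close>

text \<open>Markov's inequality: outside the ball the integrand of the Levy condition is at least
  \<open>min 1 (e\<^sup>2)\<close>.\<close>

lemma levy_measure_finite_outside_ball:
  assumes "levy_measure \<nu>" "0 < e"
  shows "emeasure \<nu> {z. e < norm z} < \<infinity>"
proof -
  have [measurable_cong]: "sets \<nu> = sets borel" and
    fin: "(\<integral>\<^sup>+ z. ennreal (min 1 ((norm z)\<^sup>2)) \<partial>\<nu>) < \<infinity>"
    using assms by (auto simp: levy_measure_def)
  define c where "c = min 1 (e\<^sup>2)"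
  have "0 < c" using assms by (simp add: c_def)
  have "ennreal c * emeasure \<nu> {z. e < norm z} = (\<integral>\<^sup>+ z. ennreal c * indicator {z. e < norm z} z \<partial>\<nu>)"
    by (simp add: nn_integral_cmult_indicator)
  also have "\<dots> \<le> (\<integral>\<^sup>+ z. ennreal (min 1 ((norm z)\<^sup>2)) \<partial>\<nu>)"
    using \<open>0 < e\<close> by (intro nn_integral_mono)
      (auto simp: c_def indicator_def intro!: ennreal_leI min.coboundedI2 power_mono)
  also note fin
  finally show ?thesis
    using \<open>0 < c\<close> by (auto simp: ennreal_mult_less_top)
qed

text \<open>Images under \<Psi> are preimages under \<open>inv \<Psi>\<close>, so the composed
  measure is a pushforward and inherits finiteness from \<open>M\<close> once
  \<open>inv \<Psi>\<close> is measurable.\<close>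

lemma comp_measure_eq_distr:
  fixes M :: "'a::topological_space measure"
  assumes "sets M = sets borel" "bij \<Psi>"
  shows "comp_measure M \<Psi> = distr M borel (inv \<Psi>)"
  using sets_eq_imp_space_eq[OF assms(1)] assms(2)
  by (simp add: comp_measure_def distr_def bij_vimage_eq_inv_image bij_imp_bij_inv inv_inv_eq)

lemma emeasure_comp_measure:
  fixes M :: "'a::topological_space measure"
  assumes "sets M = sets borel" "bij \<Psi>" "continuous_on UNIV (inv \<Psi>)" "A \<in> sets borel"
  shows "emeasure (comp_measure M \<Psi>) A = emeasure M (\<Psi> ` A)"
proof -
  have [measurable]: "inv \<Psi> \<in> M \<rightarrow>\<^sub>M borel"
    using borel_measurable_continuous_onI[OF assms(3)] assms(1) measurable_cong_sets by blast
  show ?thesis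
    using assms sets_eq_imp_space_eq[OF assms(1)]
    by (simp add: comp_measure_eq_distr emeasure_distr bij_vimage_eq_inv_image bij_imp_bij_inv inv_inv_eq)
qed

lemma sets_image_homeomorphism:
  fixes \<Psi> :: "'a::topological_space \<Rightarrow> 'b::topological_space"
  assumes "bij \<Psi>" "continuous_on UNIV (inv \<Psi>)" "A \<in> sets borel"
  shows "\<Psi> ` A \<in> sets borel"
  using measurable_sets_borel[OF borel_measurable_continuous_onI[OF assms(2)] assms(3)] assms(1)
  by (simp add: bij_vimage_eq_inv_image bij_imp_bij_inv inv_inv_eq)


lemma sets_trunc_measure [simp]: "sets (trunc_measure \<nu> n) = sets \<nu>"
  by (simp add: trunc_measure_def)

lemma emeasure_trunc_measure:
  assumes "sets \<nu> = sets borel" "A \<in> sets borel"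
  shows "emeasure (trunc_measure \<nu> n) A = emeasure \<nu> ({z. 1 / real n < norm z} \<inter> A)"
  using assms by (simp add: trunc_measure_def emeasure_restricted)

text \<open>At \<open>n = 0\<close> the radius \<open>1 / real n\<close> is \<open>0\<close>, so the
  truncation removes only the origin and may be infinite.\<close>

lemma finite_trunc_measure:
  assumes "levy_measure \<nu>" "0 < n"
  shows "finite_measure (trunc_measure \<nu> n)"
proof (rule finite_measureI)
  have "sets \<nu> = sets borel"
    using assms by (simp add: levy_measure_def)
  then show "emeasure (trunc_measure \<nu> n) (space (trunc_measure \<nu> n)) \<noteq> \<infinity>"
    using levy_measure_finite_outside_ball[OF assms(1), of "1 / real n"] \<open>0 < n\<close>
      sets_eq_imp_space_eq[of \<nu> borel]
    by (simp add: trunc_measure_def emeasure_restricted)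
qed

lemma emeasure_meet_trunc_measure:
  fixes \<nu> :: "'a::euclidean_space measure"
  assumes \<nu>: "levy_measure \<nu>" and \<Psi>: "bij \<Psi>" "continuous_on UNIV (inv \<Psi>)"
    and n: "0 < n" and A: "A \<in> sets borel"
  shows "emeasure (meet_measure (trunc_measure \<nu> n) (comp_measure (trunc_measure \<nu> n) \<Psi>)) A =
    (INF B\<in>sets borel. emeasure \<nu> ({z. 1 / real n < norm z} \<inter> (A - B))
       + emeasure \<nu> ({z. 1 / real n < norm z} \<inter> \<Psi> ` (A \<inter> B)))"
proof -
  have sets: "sets \<nu> = sets borel"
    using \<nu> by (simp add: levy_measure_def)
  let ?M = "trunc_measure \<nu> n"
  have M: "sets ?M = sets borel" by (simp add: sets)
  have fin: "finite_measure ?M" using \<nu> n by (rule finite_trunc_measure)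
  have "inv \<Psi> \<in> ?M \<rightarrow>\<^sub>M borel"
    using borel_measurable_continuous_onI[OF \<Psi>(2)] M measurable_cong_sets by blast
  then have fin': "finite_measure (comp_measure ?M \<Psi>)"
    using fin by (simp add: comp_measure_eq_distr[OF M \<Psi>(1)] finite_measure.finite_measure_distr)
  have "sets (comp_measure ?M \<Psi>) = sets ?M"
    by (simp add: comp_measure_eq_distr[OF M \<Psi>(1)] sets)
  then show ?thesis
    using A by (subst emeasure_meet_measure[OF fin fin'])
      (auto simp: M sets emeasure_comp_measure[OF M \<Psi>] emeasure_trunc_measure[OF sets]
         sets_image_homeomorphism[OF \<Psi>] intro!: INF_cong)
qed

section \<open>The measure of \<Psi>: values, domination, finiteness and pushforward\<close>

lemma sets_mu_measure [simp]: "sets (mu_measure \<nu> \<Psi>) = sets borel"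
  unfolding mu_measure_def by (metis sets.sets_measure_of_eq space_borel)

text \<open>In the infimum formula every term grows with \<open>n\<close>, so the limsup is a
  supremum of an increasing sequence of measures and hence itself a measure.\<close>

lemma emeasure_mu_measure:
  fixes \<nu> :: "'a::euclidean_space measure"
  assumes \<nu>: "levy_measure \<nu>" and \<Psi>: "bij \<Psi>" "continuous_on UNIV (inv \<Psi>)"
    and A: "A \<in> sets borel"
  shows "emeasure (mu_measure \<nu> \<Psi>) A =
    (SUP n. INF B\<in>sets borel. emeasure \<nu> ({z. 1 / real (Suc n) < norm z} \<inter> (A - B))
       + emeasure \<nu> ({z. 1 / real (Suc n) < norm z} \<inter> \<Psi> ` (A \<inter> B)))"
proof -
  have sets[measurable_cong]: "sets \<nu> = sets borel"
    using \<nu> by (simp add: levy_measure_def)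
  define m where "m n = meet_measure (trunc_measure \<nu> n) (comp_measure (trunc_measure \<nu> n) \<Psi>)" for n
  have sets_m: "sets (m n) = sets borel" for n
    by (simp add: m_def meet_measure_def sets)
  have m: "emeasure (m (Suc n)) A = (INF B\<in>sets borel.
      emeasure \<nu> ({z. 1 / real (Suc n) < norm z} \<inter> (A - B))
       + emeasure \<nu> ({z. 1 / real (Suc n) < norm z} \<inter> \<Psi> ` (A \<inter> B)))"
    if "A \<in> sets borel" for A n
    unfolding m_def using that \<nu> \<Psi> by (intro emeasure_meet_trunc_measure) auto
  have mono: "incseq (\<lambda>n. emeasure (m (Suc n)) A)" if A: "A \<in> sets borel" for A
  proof (rule incseq_SucI)
    fix n
    have sub: "{z::'a. 1 / real (Suc n) < norm z} \<subseteq> {z. 1 / real (Suc (Suc n)) < norm z}"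
      by (auto elim!: le_less_trans[rotated] intro!: divide_left_mono)
    show "emeasure (m (Suc n)) A \<le> emeasure (m (Suc (Suc n))) A"
      unfolding m[OF A]
      using sub A
      by (intro INF_superset_mono add_mono emeasure_mono)
         (auto simp: sets sets_image_homeomorphism[OF \<Psi>])
  qed
  \<comment> \<open>Shifting to \<open>Suc n\<close> leaves out the exceptional index
    \<open>0\<close>, which a limsup does not see.\<close>
  have lim: "limsup (\<lambda>n. emeasure (m n) A) = (SUP n. emeasure (m (Suc n)) A)"
    if "A \<in> sets borel" for A
    using LIMSEQ_SUP[OF mono[OF that]] LIMSEQ_imp_Suc
    by (intro lim_imp_Limsup) auto
  have "emeasure (mu_measure \<nu> \<Psi>) A = limsup (\<lambda>n. emeasure (m n) A)"
    unfolding mu_measure_def m_def[symmetric]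
  proof (rule emeasure_measure_of_sigma)
    show "sigma_algebra UNIV (sets (borel :: 'a measure))"
      by (metis sets.sigma_algebra_axioms space_borel)
    show "positive (sets borel) (\<lambda>A. limsup (\<lambda>n. emeasure (m n) A))"
      by (simp add: positive_def Limsup_const)
    show "countably_additive (sets borel) (\<lambda>A. limsup (\<lambda>n. emeasure (m n) A))"
    proof (rule countably_additiveI)
      fix A :: "nat \<Rightarrow> 'a set"
      assume A: "range A \<subseteq> sets borel" "disjoint_family A" "(\<Union>i. A i) \<in> sets borel"
      have "(\<Sum>i. limsup (\<lambda>n. emeasure (m n) (A i))) = (\<Sum>i. SUP n. emeasure (m (Suc n)) (A i))"
        using A by (intro suminf_cong lim) auto
      \<comment> \<open>Monotone convergence for series: sum and supremum commute because each term
        increases in \<open>n\<close>.\<close>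
      also have "\<dots> = (SUP n. \<Sum>i. emeasure (m (Suc n)) (A i))"
        using A mono by (intro ennreal_suminf_SUP_eq) auto
      also have "\<dots> = limsup (\<lambda>n. emeasure (m n) (\<Union>i. A i))"
        using A by (simp add: lim suminf_emeasure sets_m)
      finally show "(\<Sum>i. limsup (\<lambda>n. emeasure (m n) (A i))) = limsup (\<lambda>n. emeasure (m n) (\<Union>i. A i))" .
    qed
  qed fact
  then show ?thesis
    using A by (simp add: lim m)
qed

text \<open>The two bounds come from the choices \<open>B = {}\<close> and \<open>B = UNIV\<close>
  in the infimum.\<close>

lemma emeasure_mu_measure_le:
  fixes \<nu> :: "'a::euclidean_space measure"
  assumes \<nu>: "levy_measure \<nu>" and \<Psi>: "bij \<Psi>" "continuous_on UNIV (inv \<Psi>)"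
    and A: "A \<in> sets borel"
  shows "emeasure (mu_measure \<nu> \<Psi>) A \<le> emeasure \<nu> A"
    and "emeasure (mu_measure \<nu> \<Psi>) A \<le> emeasure \<nu> (\<Psi> ` A)"
proof -
  have sets: "sets \<nu> = sets borel"
    using \<nu> by (simp add: levy_measure_def)
  show "emeasure (mu_measure \<nu> \<Psi>) A \<le> emeasure \<nu> A"
    unfolding emeasure_mu_measure[OF assms]
    by (intro SUP_least INF_lower2[of "{}"]) (use A in \<open>auto intro!: emeasure_mono simp: sets\<close>)
  show "emeasure (mu_measure \<nu> \<Psi>) A \<le> emeasure \<nu> (\<Psi> ` A)"
    unfolding emeasure_mu_measure[OF assms]
    by (intro SUP_least INF_lower2[of UNIV])
       (use A in \<open>auto intro!: emeasure_mono simp: sets sets_image_homeomorphism[OF \<Psi>]\<close>)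
qed

text \<open>Small jumps are sent by \<open>\<Psi>\<close> near \<open>\<Psi> 0 \<noteq> 0\<close>, where \<open>\<nu>\<close> is finite; hence the two
  upper bounds of the meet measure complement each other.\<close>

lemma finite_mu_measure:
  fixes \<nu> :: "'a::euclidean_space measure"
  assumes \<nu>: "levy_measure \<nu>" and \<Psi>: "bij \<Psi>" "continuous_on UNIV \<Psi>" "continuous_on UNIV (inv \<Psi>)"
    and "\<Psi> 0 \<noteq> 0"
  shows "finite_measure (mu_measure \<nu> \<Psi>)"
proof (rule finite_measureI)
  have sets: "sets \<nu> = sets borel"
    using \<nu> by (simp add: levy_measure_def)
  let ?\<mu> = "mu_measure \<nu> \<Psi>" and ?r = "norm (\<Psi> 0) / 2"
  have "0 < ?r" using assms by simp
  then obtain e where "0 < e" and e: "\<And>z. dist z 0 < e \<Longrightarrow> dist (\<Psi> z) (\<Psi> 0) < ?r"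
    using \<Psi>(2) unfolding continuous_on_iff by (metis UNIV_I)
  have far: "?r < norm (\<Psi> z)" if "norm z < e" for z
    using e[of z] that norm_triangle_ineq2[of "\<Psi> 0" "\<Psi> z"] by (auto simp: dist_norm norm_minus_commute)
  have "emeasure ?\<mu> (ball 0 e) \<le> emeasure \<nu> (\<Psi> ` ball 0 e)"
    using emeasure_mu_measure_le(2)[OF \<nu> \<Psi>(1,3)] by simp
  also have "\<dots> \<le> emeasure \<nu> {z. ?r < norm z}"
    using far by (intro emeasure_mono) (auto simp: sets)
  also have "\<dots> < \<infinity>"
    using \<nu> \<open>0 < ?r\<close> by (rule levy_measure_finite_outside_ball)
  finally have 1: "emeasure ?\<mu> (ball 0 e) < \<infinity>" .
  have "emeasure ?\<mu> (- ball 0 e) \<le> emeasure \<nu> (- ball 0 e)"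
    using emeasure_mu_measure_le(1)[OF \<nu> \<Psi>(1,3)] by simp
  \<comment> \<open>The radius is halved because the complement of the open ball contains the sphere
    of radius \<open>e\<close>, while the finiteness bound has a strict inequality.\<close>
  also have "\<dots> \<le> emeasure \<nu> {z. e / 2 < norm z}"
    using \<open>0 < e\<close> by (intro emeasure_mono) (auto simp: sets)
  also have "\<dots> < \<infinity>"
    using \<nu> \<open>0 < e\<close> by (intro levy_measure_finite_outside_ball) auto
  finally have 2: "emeasure ?\<mu> (- ball 0 e) < \<infinity>" .
  have "space ?\<mu> = ball 0 e \<union> - ball 0 e"
    using sets_eq_imp_space_eq[OF sets_mu_measure[of \<nu> \<Psi>]] by auto
  then show "emeasure ?\<mu> (space ?\<mu>) \<noteq> \<infinity>"
    using emeasure_subadditive[of "ball 0 e" ?\<mu> "- ball 0 e"] 1 2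
    by (auto simp: ennreal_add_eq_top top_unique)
qed

text \<open>Pushing forward by \<Psi> swaps the two measures in each truncated meet: \<nu> becomes
  its composition with \<open>inv \<Psi>\<close>, and the composition with \<Psi> becomes
  \<nu>.\<close>

lemma distr_mu_measure:
  fixes \<nu> :: "'a::euclidean_space measure"
  assumes \<nu>: "levy_measure \<nu>" and \<Psi>: "bij \<Psi>" "continuous_on UNIV \<Psi>" "continuous_on UNIV (inv \<Psi>)"
  shows "distr (mu_measure \<nu> \<Psi>) borel \<Psi> = mu_measure \<nu> (inv \<Psi>)"
proof (rule measure_eqI)
  have inv: "bij (inv \<Psi>)" "continuous_on UNIV (inv (inv \<Psi>))"
    using \<Psi> by (simp_all add: bij_imp_bij_inv inv_inv_eq)
  have [measurable]: "\<Psi> \<in> borel \<rightarrow>\<^sub>M borel"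
    using \<Psi>(2) by (rule borel_measurable_continuous_onI)
  have m: "\<Psi> \<in> mu_measure \<nu> \<Psi> \<rightarrow>\<^sub>M borel"
    using measurable_cong_sets[OF sets_mu_measure refl] \<open>\<Psi> \<in> borel \<rightarrow>\<^sub>M borel\<close> by blast
  have inj: "\<Psi> x = \<Psi> y \<longleftrightarrow> x = y" and [simp]: "\<Psi> (inv \<Psi> x) = x" "inv \<Psi> (\<Psi> x) = x" for x y
    using \<Psi>(1) by (auto simp: bij_def surj_f_inv_f inj_eq)
  fix A assume "A \<in> sets (distr (mu_measure \<nu> \<Psi>) borel \<Psi>)"
  then have A[measurable]: "A \<in> sets borel" by simp
  have A': "\<Psi> -` A \<in> sets borel"
    using measurable_sets[of \<Psi> borel borel A] by simp
  let ?F = "\<lambda>n B. emeasure \<nu> ({z. 1 / real (Suc n) < norm z} \<inter> (\<Psi> -` A - B))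
       + emeasure \<nu> ({z. 1 / real (Suc n) < norm z} \<inter> \<Psi> ` (\<Psi> -` A \<inter> B))"
  let ?G = "\<lambda>n B. emeasure \<nu> ({z. 1 / real (Suc n) < norm z} \<inter> (A - B))
       + emeasure \<nu> ({z. 1 / real (Suc n) < norm z} \<inter> inv \<Psi> ` (A \<inter> B))"
  \<comment> \<open>The complement of the image of \<open>B\<close> exchanges the two summands. This
    correspondence is invertible on Borel sets, as \<open>GF\<close> records, so the infima
    agree.\<close>
  have FG: "?F n B = ?G n (- \<Psi> ` B)" for n B
  proof -
    have "\<Psi> -` A - B = inv \<Psi> ` (A \<inter> - \<Psi> ` B)"
      by (force simp: inj image_iff)
    moreover have "\<Psi> ` (\<Psi> -` A \<inter> B) = A - - \<Psi> ` B"
      by auto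
    ultimately show ?thesis by (simp add: add.commute)
  qed
  have GF: "?G n B = ?F n (\<Psi> -` (- B))" for n B
  proof -
    have "- \<Psi> ` (\<Psi> -` (- B)) = B"
      using \<Psi>(1) by (simp add: bij_def surj_image_vimage_eq)
    then show ?thesis
      unfolding FG by simp
  qed
  have "(INF B\<in>sets borel. ?F n B) = (INF B\<in>sets borel. ?G n B)" for n
  proof (rule antisym)
    show "(INF B\<in>sets borel. ?F n B) \<le> (INF B\<in>sets borel. ?G n B)"
    proof (rule INF_mono)
      fix B :: "'a set" assume "B \<in> sets borel"
      then have "\<Psi> -` (- B) \<in> sets borel"
        using measurable_sets[of \<Psi> borel borel "- B"] by simp
      then show "\<exists>B'\<in>sets borel. ?F n B' \<le> ?G n B"
        using GF by (metis order_refl)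
    qed
    show "(INF B\<in>sets borel. ?G n B) \<le> (INF B\<in>sets borel. ?F n B)"
    proof (rule INF_mono)
      fix B :: "'a set" assume "B \<in> sets borel"
      then have "- \<Psi> ` B \<in> sets borel"
        using sets_image_homeomorphism[OF \<Psi>(1,3)] by auto
      then show "\<exists>B'\<in>sets borel. ?G n B' \<le> ?F n B"
        using FG by (metis order_refl)
    qed
  qed
  then show "emeasure (distr (mu_measure \<nu> \<Psi>) borel \<Psi>) A = emeasure (mu_measure \<nu> (inv \<Psi>)) A"
    using sets_eq_imp_space_eq[OF sets_mu_measure[of \<nu> \<Psi>]] A A'
    by (simp add: emeasure_distr[OF m] emeasure_mu_measure[OF \<nu> \<Psi>(1,3)]
      emeasure_mu_measure[OF \<nu> inv])
qed simp

section \<open>Integrals against sums and multiples of measures\<close>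

text \<open>Additivity is assumed through values on sets, so that \<open>D\<close> can be \<nu>
  itself, split into a dominated measure and the remaining \<open>diff_measure\<close>.\<close>

lemma nn_integral_add_measure:
  assumes sets_eq: "sets M = sets D" "sets N = sets D"
    and D: "\<And>A. A \<in> sets D \<Longrightarrow> emeasure D A = emeasure M A + emeasure N A"
    and f: "f \<in> borel_measurable D"
  shows "nn_integral D f = nn_integral M f + nn_integral N f"
proof -
  note sets_eq[measurable_cong]
  have sp[simp]: "space M = space D" "space N = space D"
    using sets_eq by (auto dest: sets_eq_imp_space_eq)
  from f show ?thesis
  proof induction
    case (cong f g)
    then show ?case
      by (simp cong: nn_integral_cong_simp)
  next
    case (set A)
    then show ?case
      using D by (simp add: sets_eq)
  next
    case (mult u c)
    note [measurable] = mult(2)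
    show ?case
      using mult(4) by (simp add: nn_integral_cmult distrib_left)
  next
    case (add u v)
    then show ?case by (simp add: nn_integral_add ac_simps)
  next
    case (seq U)
    note [measurable] = seq(1)
    have "(\<integral>\<^sup>+a. (SUP i. U i a) \<partial>M) = (SUP i. nn_integral M (U i))"
      "(\<integral>\<^sup>+a. (SUP i. U i a) \<partial>N) = (SUP i. nn_integral N (U i))"
      "(\<integral>\<^sup>+a. (SUP i. U i a) \<partial>D) = (SUP i. nn_integral D (U i))"
      using \<open>incseq U\<close> by (simp_all add: nn_integral_monotone_convergence_SUP)
    moreover have "incseq (\<lambda>i. nn_integral M (U i))" "incseq (\<lambda>i. nn_integral N (U i))"
      using \<open>incseq U\<close> by (auto simp: incseq_def le_fun_def intro!: nn_integral_mono)
    ultimately show ?case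
      using seq.IH by (simp add: ennreal_SUP_add image_comp)
  qed
qed

lemma integral_add_measure:
  fixes f :: "'a \<Rightarrow> real"
  assumes sets_eq: "sets M = sets D" "sets N = sets D"
    and D: "\<And>A. A \<in> sets D \<Longrightarrow> emeasure D A = emeasure M A + emeasure N A"
    and f: "integrable D f"
  shows "integrable M f" "integrable N f" "integral\<^sup>L D f = integral\<^sup>L M f + integral\<^sup>L N f"
proof -
  note sets_eq[measurable_cong]
  have [measurable]: "f \<in> borel_measurable D"
    using f by auto
  note add = nn_integral_add_measure[OF sets_eq D]
  show M: "integrable M f" and N: "integrable N f"
    using f by (simp_all add: real_integrable_def add)
  show "integral\<^sup>L D f = integral\<^sup>L M f + integral\<^sup>L N f"
    using f M N
    by (simp add: real_lebesgue_integral_def real_integrable_def add enn2real_plus less_top)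
qed

lemma integral_scale_measure:
  fixes f :: "'a \<Rightarrow> real"
  assumes "integrable (scale_measure r M) f" and r: "0 < r" "r < \<infinity>"
  shows "integrable M f" "integral\<^sup>L (scale_measure r M) f = enn2real r * integral\<^sup>L M f"
proof -
  have [measurable]: "f \<in> borel_measurable M"
    using borel_measurable_integrable[OF assms(1)] measurable_cong_sets[OF sets_scale_measure refl]
    by blast
  have scale: "(\<integral>\<^sup>+x. ennreal (f x) \<partial>scale_measure r M) = r * (\<integral>\<^sup>+x. ennreal (f x) \<partial>M)"
    "(\<integral>\<^sup>+x. ennreal (- f x) \<partial>scale_measure r M) = r * (\<integral>\<^sup>+x. ennreal (- f x) \<partial>M)"
    by (rule nn_integral_scale_measure; measurable)+
  show M: "integrable M f"
    unfolding real_integrable_def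
  proof (intro conjI)
    have "r * (\<integral>\<^sup>+x. ennreal (f x) \<partial>M) \<noteq> \<infinity>" "r * (\<integral>\<^sup>+x. ennreal (- f x) \<partial>M) \<noteq> \<infinity>"
      using assms(1) unfolding real_integrable_def scale by blast+
    then show "(\<integral>\<^sup>+x. ennreal (f x) \<partial>M) \<noteq> \<infinity>" "(\<integral>\<^sup>+x. ennreal (- f x) \<partial>M) \<noteq> \<infinity>"
      \<comment> \<open>As \<open>0 < r\<close>, an infinite integral would stay infinite after
        scaling.\<close>
      using r(1) by (metis ennreal_mult_top infinity_ennreal_def less_irrefl)+
  qed fact
  show "integral\<^sup>L (scale_measure r M) f = enn2real r * integral\<^sup>L M f"
    unfolding real_lebesgue_integral_def[OF assms(1)] real_lebesgue_integral_def[OF M] scale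
    by (simp add: enn2real_mult right_diff_distrib)
qed

section \<open>Gradients and the second-order remainder\<close>

text \<open>Riesz representation in coordinates supplies a gradient, and uniqueness of derivatives
  makes the definite description in \<open>gradient\<close> pick it.\<close>

lemma has_derivative_eq_gradient:
  fixes f :: "'a::euclidean_space \<Rightarrow> real"
  assumes "(f has_derivative f') (at x)"
  shows "f' = (\<lambda>h. gradient f x \<bullet> h)"
proof -
  interpret f': linear f'
    using assms by (rule has_derivative_linear)
  define S where "S = (\<Sum>i\<in>Basis. f' i *\<^sub>R i)"
  have "f' h = h \<bullet> S" for h
  proof -
    have "f' h = f' (\<Sum>i\<in>Basis. (h \<bullet> i) *\<^sub>R i)"
      by (simp only: euclidean_representation)
    also have "\<dots> = h \<bullet> S"
      by (simp add: S_def f'.sum f'.scale inner_sum_right mult.commute)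
    finally show ?thesis .
  qed
  then have eq: "f' = (\<lambda>h. h \<bullet> S)"
    by blast
  have S: "GDERIV f x :> S"
    using assms unfolding gderiv_def eq .
  have "gradient f x = S"
    unfolding gradient_def
  proof (rule the_equality)
    fix D assume "GDERIV f x :> D"
    then have "(\<lambda>h. h \<bullet> D) = (\<lambda>h. h \<bullet> S)"
      using S unfolding gderiv_def by (rule has_derivative_unique)
    then show "D = S"
      by (metis vector_eq_ldot)
  qed fact
  then show "f' = (\<lambda>h. gradient f x \<bullet> h)"
    by (simp add: eq inner_commute)
qed

text \<open>No differentiability is assumed: both definite descriptions have the same candidates
  \<open>D\<close>, even if there are none.\<close>

lemma gradient_add_const:
  fixes f :: "'a::real_inner \<Rightarrow> real"
  shows "gradient (\<lambda>u. f u + c) x = gradient f x" "gradient (\<lambda>u. c + f u) x = gradient f x"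
proof -
  have "GDERIV (\<lambda>u. f u + c) x :> D \<longleftrightarrow> GDERIV f x :> D" for D and f :: "'a \<Rightarrow> real" and c
    using has_derivative_add_const[of f _ "at x" c]
      has_derivative_add_const[of "\<lambda>u. f u + c" _ "at x" "- c"]
    by (auto simp: gderiv_def)
  then show "gradient (\<lambda>u. f u + c) x = gradient f x" "gradient (\<lambda>u. c + f u) x = gradient f x"
    by (simp_all add: gradient_def add.commute[of c])
qed

text \<open>The mean value inequality is applied twice: to \<open>f'\<close>, which is therefore
  Lipschitz with constant \<open>C\<close>, and to \<open>f\<close> minus its linear part at
  \<open>x\<close>, whose derivative on the ball of radius \<open>norm h\<close> is then at most
  \<open>C * norm h\<close>.\<close>

lemma Cb2_quadratic_remainder:
  fixes f :: "'a::euclidean_space \<Rightarrow> real"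
  assumes "f \<in> Cb2"
  obtains C where "\<And>x h. \<bar>f (x + h) - f x - gradient f x \<bullet> h\<bar> \<le> C * (norm h)\<^sup>2" "0 \<le> C"
proof -
  obtain f' :: "'a \<Rightarrow> 'a \<Rightarrow>\<^sub>L real" and f'' :: "'a \<Rightarrow> 'a \<Rightarrow>\<^sub>L ('a \<Rightarrow>\<^sub>L real)" where
    f': "\<And>x. (f has_derivative blinfun_apply (f' x)) (at x)" and
    f'': "\<And>x. (f' has_derivative blinfun_apply (f'' x)) (at x)" and bdd: "bounded (range f'')"
    using assms unfolding Cb2_def by blast
  obtain C where C: "\<And>x. norm (f'' x) \<le> C"
    using bdd unfolding bounded_iff by blast
  have "0 \<le> C"
    using C[of 0] norm_ge_zero[of "f'' 0"] by linarith
  have lip: "norm (f' u - f' x) \<le> C * norm (u - x)" for u x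
    using f'' C by (intro differentiable_bound[where S = UNIV and f' = "\<lambda>x. blinfun_apply (f'' x)"])
      (auto simp flip: norm_blinfun.rep_eq)
  have "\<bar>f (x + h) - f x - gradient f x \<bullet> h\<bar> \<le> C * (norm h)\<^sup>2" for x h
  proof -
    let ?g = "\<lambda>u. f u - blinfun_apply (f' x) u"
    have "norm (?g (x + h) - ?g x) \<le> (C * norm h) * norm (x + h - x)"
    proof (rule differentiable_bound[where S = "cball x (norm h)" and f' = "\<lambda>u. blinfun_apply (f' u - f' x)"])
      fix u assume "u \<in> cball x (norm h)"
      then have "norm (u - x) \<le> norm h"
        by (simp add: dist_norm norm_minus_commute)
      then show "onorm (blinfun_apply (f' u - f' x)) \<le> C * norm h"
        using lip[of u x] \<open>0 \<le> C\<close> by (simp flip: norm_blinfun.rep_eq)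
          (meson mult_left_mono order_trans)
      have "(?g has_derivative (\<lambda>v. f' u v - f' x v)) (at u within cball x (norm h))"
        by (intro has_derivative_diff has_derivative_at_withinI[OF f']
            bounded_linear_imp_has_derivative blinfun.bounded_linear_right)
      moreover have "(\<lambda>v. f' u v - f' x v) = blinfun_apply (f' u - f' x)"
        by (auto simp: blinfun.diff_left)
      ultimately show "(?g has_derivative blinfun_apply (f' u - f' x)) (at u within cball x (norm h))"
        by simp
    qed (auto simp: dist_norm)
    moreover have "blinfun_apply (f' x) h = gradient f x \<bullet> h"
      using has_derivative_eq_gradient[OF f'] by metis
    ultimately show ?thesis
      by (simp add: blinfun.add_right power2_eq_square algebra_simps)
  qed
  then show ?thesis
    using that \<open>0 \<le> C\<close> by blast
qed

text \<open>The integrand is dominated by a multiple of \<open>min 1 ((norm z)\<^sup>2)\<close>, the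
  function that a Levy measure integrates.\<close>

lemma integrable_levy_integrand:
  fixes f :: "real^'d \<Rightarrow> real" and S :: "real^'d^'d"
  assumes \<nu>: "levy_measure \<nu>" and f: "f \<in> Cb2"
  shows "integrable \<nu> (\<lambda>z. f (x + S *v z) - f x
            - (gradient f x \<bullet> (S *v z)) * indicator {w. norm w \<le> 1} z)" (is "integrable \<nu> ?F")
proof -
  have [measurable_cong]: "sets \<nu> = sets borel" and
    fin: "(\<integral>\<^sup>+ z. ennreal (min 1 ((norm z)\<^sup>2)) \<partial>\<nu>) < \<infinity>"
    using \<nu> by (auto simp: levy_measure_def)
  obtain C where C: "\<And>x h. \<bar>f (x + h) - f x - gradient f x \<bullet> h\<bar> \<le> C * (norm h)\<^sup>2" "0 \<le> C"
    using f by (rule Cb2_quadratic_remainder) blast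
  obtain B where B: "\<And>x. \<bar>f x\<bar> \<le> B"
    using f unfolding Cb2_def bounded_iff by auto
  have "0 \<le> B" using B[of 0] by linarith
  obtain k where k: "\<And>z. norm (S *v z) \<le> k * norm z" "0 < k"
    using linear_bounded_pos[OF matrix_vector_mul_linear[of S]] by blast
  have "continuous_on UNIV f"
    using f unfolding Cb2_def
    by (auto intro!: continuous_at_imp_continuous_on intro: has_derivative_continuous)
  then have [measurable]: "f \<in> borel_measurable borel"
    by (rule borel_measurable_continuous_onI)
  have [measurable]: "(\<lambda>z. S *v z) \<in> borel \<rightarrow>\<^sub>M borel"
    by (intro borel_measurable_continuous_onI matrix_vector_mult_linear_continuous_on)
  \<comment> \<open>The term \<open>2 * B\<close> bounds the increment of \<open>f\<close> for large
    jumps, where the indicator vanishes; \<open>C * k\<^sup>2\<close> comes from the Taylor bound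
    for small ones, with \<open>k\<close> bounding the linear map \<open>S\<close>.\<close>
  define K where "K = 2 * B + C * k\<^sup>2"
  have bound: "\<bar>?F z\<bar> \<le> K * min 1 ((norm z)\<^sup>2)" for z
  proof (cases "norm z \<le> 1")
    case True
    have "\<bar>?F z\<bar> \<le> C * (norm (S *v z))\<^sup>2"
      using C(1)[of x "S *v z"] True by simp
    also have "\<dots> \<le> C * (k * norm z)\<^sup>2"
      using k C(2) by (intro mult_left_mono power_mono) auto
    also have "\<dots> \<le> K * (norm z)\<^sup>2"
      using \<open>0 \<le> B\<close> by (simp add: K_def power_mult_distrib algebra_simps)
    also have "(norm z)\<^sup>2 = min 1 ((norm z)\<^sup>2)"
      using True by (simp add: power_le_one)
    finally show ?thesis .
  next
    case False
    then have "\<bar>?F z\<bar> \<le> 2 * B"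
      using B[of x] B[of "x + S *v z"] by simp
    also have "\<dots> \<le> K"
      using C(2) by (simp add: K_def)
    also have "K = K * min 1 ((norm z)\<^sup>2)"
      using False by (simp add: one_le_power)
    finally show ?thesis .
  qed
  have "integrable \<nu> (\<lambda>z. min 1 ((norm z)\<^sup>2))"
    using fin by (intro integrableI_nonneg) auto
  then have "integrable \<nu> (\<lambda>z. K * min 1 ((norm z)\<^sup>2))"
    by simp
  then show ?thesis
  proof (rule Bochner_Integration.integrable_bound)
    show "AE z in \<nu>. norm (?F z) \<le> norm (K * min 1 ((norm z)\<^sup>2))"
      unfolding real_norm_def by (intro AE_I2 order_trans[OF bound abs_ge_self])
  qed measurable
qed

section \<open>Recombining the three jump measures into \<nu>\<close>

text \<open>The factors \<open>1/2\<close> keep the sum of the two scaled measures below \<nu>, so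
  neither subtraction is cut off at zero and \<nu> is the sum of \<open>D\<close> and the two
  halves.\<close>

lemma integral_diff_half_measures:
  fixes f :: "'a \<Rightarrow> real"
  assumes M: "finite_measure M" "sets M = sets \<nu>" "\<And>A. A \<in> sets \<nu> \<Longrightarrow> emeasure M A \<le> emeasure \<nu> A"
    and N: "finite_measure N" "sets N = sets \<nu>" "\<And>A. A \<in> sets \<nu> \<Longrightarrow> emeasure N A \<le> emeasure \<nu> A"
    and f: "integrable \<nu> f"
  defines "D \<equiv> diff_measure (diff_measure \<nu> (scale_measure (1/2) M)) (scale_measure (1/2) N)"
  shows "integrable M f" "integrable N f" "integrable D f"
    "integral\<^sup>L \<nu> f = 1/2 * integral\<^sup>L M f + 1/2 * integral\<^sup>L N f + integral\<^sup>L D f"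
proof -
  have half: "(1/2::ennreal) + 1/2 = 1"
    by (simp add: ennreal_divide_self flip: add_divide_distrib_ennreal)
  have half_eq: "(1/2::ennreal) = ennreal (1/2)"
    using ennreal_divide_numeral[of 1 "num.Bit0 num.One"] by simp
  have half_lt: "(1/2::ennreal) < top" "(0::ennreal) < 1/2" "enn2real (1/2) = 1/2"
    unfolding half_eq
    by (rule ennreal_less_top, subst ennreal_less_zero_iff, simp, rule enn2real_ennreal, simp)
  have half_le: "(1/2::ennreal) * v \<le> v" for v
  proof -
    have "(1/2::ennreal) \<le> 1/2 + 1/2"
      by (rule add_increasing2) (rule zero_le, rule order_refl)
    then have "1/2 * v \<le> 1 * v"
      unfolding half by (intro mult_right_mono zero_le)
    then show ?thesis
      by (simp only: mult_1_left)
  qed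
  have finM: "finite_measure (scale_measure (1/2) M)" and finN: "finite_measure (scale_measure (1/2) N)"
    using M(1) N(1) half_lt
    by (auto intro!: finite_measureI simp: space_scale_measure ennreal_mult_eq_top_iff
        finite_measure.emeasure_finite)
  let ?E = "diff_measure \<nu> (scale_measure (1/2) M)"
  have leM: "1/2 * emeasure M A \<le> emeasure \<nu> A" if "A \<in> sets \<nu>" for A
    using half_le[of "emeasure M A"] M(3)[OF that] by (rule order_trans)
  have E: "emeasure ?E A = emeasure \<nu> A - 1/2 * emeasure M A" if "A \<in> sets \<nu>" for A
    using that M(2) leM finM by (subst emeasure_diff_measure_finite) auto
  have leN: "1/2 * emeasure N A \<le> emeasure ?E A" if "A \<in> sets \<nu>" for A
  proof -
    have "1/2 * emeasure N A + 1/2 * emeasure M A \<le> 1/2 * emeasure \<nu> A + 1/2 * emeasure \<nu> A"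
      using M(3)[OF that] N(3)[OF that] by (intro add_mono mult_left_mono) auto
    also have "\<dots> = emeasure \<nu> A"
      by (simp flip: distrib_right add: half)
    finally show ?thesis
      using E[OF that] by (simp add: ennreal_le_minus_iff)
  qed
  have D: "emeasure D A = emeasure ?E A - 1/2 * emeasure N A" if "A \<in> sets \<nu>" for A
    unfolding D_def using that N(2) leN finN by (subst emeasure_diff_measure_finite) auto
  \<comment> \<open>The splitting is done twice: \<nu> into half of \<open>M\<close> and
    \<open>?E\<close>, then \<open>?E\<close> into half of \<open>N\<close> and
    \<open>D\<close>.\<close>
  have "integrable (scale_measure (1/2) M) f" "integrable ?E f"
    "integral\<^sup>L \<nu> f = integral\<^sup>L (scale_measure (1/2) M) f + integral\<^sup>L ?E f"
    using integral_add_measure[of "scale_measure (1/2) M" \<nu> ?E f] M(2) f leM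
    by (auto simp: E add_diff_inverse_ennreal)
  moreover from this have "integrable (scale_measure (1/2) N) f" "integrable D f"
    "integral\<^sup>L ?E f = integral\<^sup>L (scale_measure (1/2) N) f + integral\<^sup>L D f"
    using integral_add_measure[of "scale_measure (1/2) N" ?E D f] N(2) leN
    by (auto simp: D add_diff_inverse_ennreal) (simp_all add: D_def)
  ultimately show "integrable M f" "integrable N f" "integrable D f"
    "integral\<^sup>L \<nu> f = 1/2 * integral\<^sup>L M f + 1/2 * integral\<^sup>L N f + integral\<^sup>L D f"
    using integral_scale_measure[of "1/2" M f] integral_scale_measure[of "1/2" N f] half_lt
    by simp_all
qed

theorem theorem2p2:
  fixes b :: "real^'d \<Rightarrow> real^'d"
    and \<sigma> :: "real^'d \<Rightarrow> real^'d^'d"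
    and \<nu> :: "(real^'d) measure"
    and \<Psi> :: "real^'d \<Rightarrow> real^'d"
  assumes "b \<in> borel_measurable borel"
    and "continuous_on UNIV \<sigma>"
    and "levy_measure \<nu>"
    and "continuous_on UNIV \<Psi>"
    and "bij \<Psi>"
    and "\<Psi> 0 \<noteq> 0"
  shows "is_coupling_operator (coupled_levy_op b \<sigma> \<nu> \<Psi>) (levy_op b \<sigma> \<nu>)"
proof -
  note \<nu> = \<open>levy_measure \<nu>\<close>
  have sets: "sets \<nu> = sets borel"
    using \<nu> by (simp add: levy_measure_def)
  have inv_\<Psi>: "\<And>x. inv \<Psi> (\<Psi> x) = x" "\<And>x. \<Psi> (inv \<Psi> x) = x" "inv (inv \<Psi>) = \<Psi>" "bij (inv \<Psi>)"
    using \<open>bij \<Psi>\<close> by (auto simp: bij_is_surj bij_is_inj surj_f_inv_f bij_imp_bij_inv inv_inv_eq)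
  have cont_inv: "continuous_on UNIV (inv \<Psi>)"
    using continuous_on_inverse_open[of UNIV \<Psi> "inv \<Psi>"] assms(4,5) inv_\<Psi>(1) by (simp add: bij_is_surj)
  \<comment> \<open>This is the condition at the origin that \<open>finite_mu_measure\<close>
    requires for \<open>inv \<Psi>\<close>.\<close>
  have inv0: "inv \<Psi> 0 \<noteq> 0"
    using \<open>\<Psi> 0 \<noteq> 0\<close> inv_\<Psi>(2) by metis
  let ?M = "mu_measure \<nu> \<Psi>" and ?N = "mu_measure \<nu> (inv \<Psi>)"
  let ?D = "diff_measure (diff_measure \<nu> (scale_measure (1/2) ?M)) (scale_measure (1/2) ?N)"
  have M: "finite_measure ?M" "sets ?M = sets \<nu>" "\<And>A. A \<in> sets \<nu> \<Longrightarrow> emeasure ?M A \<le> emeasure \<nu> A"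
    using finite_mu_measure[OF \<nu>] emeasure_mu_measure_le(1)[OF \<nu>] assms cont_inv by (auto simp: sets)
  have N: "finite_measure ?N" "sets ?N = sets \<nu>" "\<And>A. A \<in> sets \<nu> \<Longrightarrow> emeasure ?N A \<le> emeasure \<nu> A"
    using finite_mu_measure[OF \<nu> inv_\<Psi>(4)] emeasure_mu_measure_le(1)[OF \<nu> inv_\<Psi>(4)] assms cont_inv inv0
    by (auto simp: sets inv_\<Psi>(3))
  have distr: "distr ?M borel \<Psi> = ?N" "distr ?N borel (inv \<Psi>) = ?M"
    using distr_mu_measure[OF \<nu>, of \<Psi>] distr_mu_measure[OF \<nu>, of "inv \<Psi>"] assms cont_inv inv_\<Psi>(3,4)
    by auto
  have meas: "\<Psi> \<in> ?M \<rightarrow>\<^sub>M borel" "inv \<Psi> \<in> ?N \<rightarrow>\<^sub>M borel"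
    using borel_measurable_continuous_onI[OF assms(4)] borel_measurable_continuous_onI[OF cont_inv]
      measurable_cong_sets[OF sets_mu_measure refl] by blast+
  show ?thesis
    unfolding is_coupling_operator_def
  proof (intro ballI allI)
    fix f g :: "real^'d \<Rightarrow> real" and x y
    assume f: "f \<in> Cb2" and g: "g \<in> Cb2"
    define F where "F z = f (x + \<sigma> x *v z) - f x
            - (gradient f x \<bullet> (\<sigma> x *v z)) * indicator {w. norm w \<le> 1} z" for z
    define G where "G z = g (y + \<sigma> y *v z) - g y
            - (gradient g y \<bullet> (\<sigma> y *v z)) * indicator {w. norm w \<le> 1} z" for z
    have F: "integrable \<nu> F" and G: "integrable \<nu> G"
      unfolding F_def[abs_def] G_def[abs_def]
      by (rule integrable_levy_integrand[OF \<nu> f], rule integrable_levy_integrand[OF \<nu> g])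
    note F' = integral_diff_half_measures[OF M N F]
    note G' = integral_diff_half_measures[OF M N G]
    have G_meas: "G \<in> borel_measurable borel"
      using borel_measurable_integrable[OF G] measurable_cong_sets[OF sets refl] by blast
    have G\<Psi>: "integrable ?M (\<lambda>z. G (\<Psi> z))" "integral\<^sup>L ?N G = (\<integral>z. G (\<Psi> z) \<partial>?M)"
      using integrable_distr[OF meas(1), of G] integral_distr[OF meas(1) G_meas] G'(2)
      unfolding distr by blast+
    have G\<Psi>': "integrable ?N (\<lambda>z. G (inv \<Psi> z))" "integral\<^sup>L ?M G = (\<integral>z. G (inv \<Psi> z) \<partial>?N)"
      using integrable_distr[OF meas(2), of G] integral_distr[OF meas(2) G_meas] G'(1)
      unfolding distr by blast+
    let ?h = "\<lambda>(u, v). f u + g v"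
    have grad: "grad1 ?h x y = gradient f x" "grad2 ?h x y = gradient g y"
      by (simp_all add: grad1_def grad2_def gradient_add_const)
    \<comment> \<open>In the second variable the cut-off is imposed on the transformed jump, so that
      variable contributes exactly \<open>G\<close> evaluated at \<open>\<Psi> z\<close>, at
      \<open>inv \<Psi> z\<close> and at \<open>z\<close>.\<close>
    have "coupled_levy_op b \<sigma> \<nu> \<Psi> ?h x y = gradient f x \<bullet> b x + gradient g y \<bullet> b y
        + 1/2 * (\<integral>z. F z + G (\<Psi> z) \<partial>?M) + 1/2 * (\<integral>z. F z + G (inv \<Psi> z) \<partial>?N)
        + (\<integral>z. F z + G z \<partial>?D)"
      unfolding coupled_levy_op_def grad F_def G_def
      by (intro arg_cong2[where f="(+)"] arg_cong2[where f="(*)"] refl Bochner_Integration.integral_cong) auto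
    \<comment> \<open>The change of variables swaps \<open>?M\<close> and \<open>?N\<close> for
      \<open>G\<close>. Both carry the weight \<open>1/2\<close>, so the swap leaves the total
      unchanged and \<open>G\<close>, like \<open>F\<close>, is integrated against all of
      \<nu>.\<close>
    also have "\<dots> = gradient f x \<bullet> b x + gradient g y \<bullet> b y + integral\<^sup>L \<nu> F + integral\<^sup>L \<nu> G"
      using F'(4) G'(4) G\<Psi>(2) G\<Psi>'(2)
        Bochner_Integration.integral_add[OF F'(1) G\<Psi>(1)]
        Bochner_Integration.integral_add[OF F'(2) G\<Psi>'(1)]
        Bochner_Integration.integral_add[OF F'(3) G'(3)]
      by linarith
    also have "\<dots> = levy_op b \<sigma> \<nu> f x + levy_op b \<sigma> \<nu> g y"
      by (simp add: levy_op_def F_def[abs_def] G_def[abs_def])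
    finally show "coupled_levy_op b \<sigma> \<nu> \<Psi> ?h x y = levy_op b \<sigma> \<nu> f x + levy_op b \<sigma> \<nu> g y" .
  qed
qed

end
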